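(* Let $A,B,Y\subseteq\mathbb F_2^n$ with $A\ne\varnothing$ and $Y\subseteq B$, and let $H\le\mathbb F_2^n$ be a subspace. Suppose that $$|A+A|\le K|A|,\qquad |A\triangle B|\le\eta|A|\ \ (0\le\eta<1),\qquad |Y|\ge\gamma|B|\ \ (0<\gamma\le1),$$ $$|H|\le|Y|,\qquad \mathcal N_H(Y)\le P.$$ If $\Delta(\gamma,\eta)>0$, then from any basis of $H$ one can construct a subspace $V\le H$ such that $$|V|\le|A|\qquad\text{and}\qquad\mathcal N_V(A)\le\frac{2KP}{\Delta(\gamma,\eta)}.$$ The construction does not use $A$, $|A|$, or $\eta$.
   Context: For $S,T\subseteq\mathbb F_2^n$, $S+T=\{s+t:s\in S,t\in T\}$; $\triangle$ is symmetric difference. For a subspace $V$ and a set $S$, $\mathcal N_V(S)=\min\{|T|:S\subseteq T+V\}$ is the minimum number of $V$-cosets needed to cover $S$. For $\gamma\in[0,1]$ and $\eta\ge0$, $\Delta(\gamma,\eta):=\gamma-\max\{\gamma,1-\gamma\}\,\eta$. *)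

theory Defs
  imports "HOL-Analysis.Analysis" "HOL-Library.Z2" "HOL-Library.Set_Algebras"
begin

text \<open>
  The field \<open>\<bbbF>\<^sub>2\<close> is \<^typ>\<open>bit\<close>, and \<open>\<bbbF>\<^sub>2\<^sup>n\<close> is \<open>bit ^ 'n\<close> with \<open>n = CARD('n)\<close>. The sumset \<open>S + T\<close> is
  the one of \<^theory>\<open>HOL-Library.Set_Algebras\<close>. The instance below makes \<open>bit ^ 'n\<close> a finite type,
  so that every subset of it is finite and \<^const>\<open>card\<close> is its true cardinality.
\<close>

instance bit :: finite
proof
  have "(UNIV :: bit set) = {0, 1}"
    using bit_not_zero_iff by blast
  then show "finite (UNIV :: bit set)"
    by (metis finite.emptyI finite.insertI)
qed

text \<open>
  On a finite type and for \<open>0 \<in> V\<close>, the set minimised over is finite and nonempty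
  (it contains \<open>card S\<close>).
\<close>

definition covering_number :: "'a::plus set \<Rightarrow> 'a set \<Rightarrow> nat" where
  "covering_number V S = Min {card T | T. S \<subseteq> T + V}"

definition Delta :: "real \<Rightarrow> real \<Rightarrow> real" where
  "Delta \<gamma> \<eta> = \<gamma> - max \<gamma> (1 - \<gamma>) * \<eta>"

end

theory Submission
  imports Defs
begin

text \<open>
  Deleting one vector from the given basis of \<open>H\<close> produces \<open>V\<close>; as \<open>card H \<le> card Y \<le> card B < 2 * card A\<close>,
  this halving already brings the size down to \<open>card A\<close>, and it at most doubles covering numbers.
  For the covering number of \<open>A\<close> by \<open>H\<close>, some coset of \<open>H\<close> contains a piece \<open>W\<close> of \<open>A \<inter> Y\<close> with
  \<open>card (A \<inter> Y) \<le> P * card W\<close>. The translates of \<open>W\<close> by elements of \<open>A\<close> in distinct cosets of \<open>H\<close>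
  are disjoint subsets of \<open>A + A\<close>, so there are at most \<open>K * card A / card W\<close> of them. Finally
  \<open>card (A \<inter> Y) \<ge> Delta \<gamma> \<eta> * card A\<close>.
\<close>

lemma finite_covering_sizes:
  fixes V S :: "'a::{plus,finite} set"
  shows "finite {card T | T. S \<subseteq> T + V}"
  by (rule finite_subset[of _ "card ` UNIV"]) auto

lemma covering_number_le:
  fixes V S :: "'a::{plus,finite} set"
  assumes "S \<subseteq> T + V"
  shows "covering_number V S \<le> card T"
  unfolding covering_number_def
  by (rule Min_le[OF finite_covering_sizes]) (use assms in blast)

lemma covering_number_attained:
  fixes V S :: "'a::{monoid_add,finite} set"
  assumes "0 \<in> V"
  obtains T where "S \<subseteq> T + V" "card T = covering_number V S"
proof -
  have "S \<subseteq> S + V"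
    using assms by (metis add_0_right set_plus_intro subsetI)
  then have "covering_number V S \<in> {card T | T. S \<subseteq> T + V}"
    unfolding covering_number_def by (intro Min_in finite_covering_sizes) blast
  then show thesis
    using that by auto
qed

lemma card_set_plus_le:
  fixes S T :: "'a::{plus,finite} set"
  shows "card (S + T) \<le> card S * card T"
  unfolding set_plus_image
  using card_image_le[of "S \<times> T" "\<lambda>(x, y). x + y"] by (simp add: card_cartesian_product)

text \<open>Each translate of \<open>H\<close> in an optimal cover of \<open>S\<close> splits into
  at most \<open>card R\<close> translates of \<open>V\<close>. With \<open>card R \<le> 2\<close>
  this bounds the cost of deleting a basis vector.\<close>

lemma covering_number_le_mult:
  fixes H V S :: "'a::{comm_monoid_add,finite} set"
  assumes "0 \<in> H" and "H \<subseteq> R + V"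
  shows "covering_number V S \<le> card R * covering_number H S"
proof -
  obtain T where T: "S \<subseteq> T + H" "card T = covering_number H S"
    using covering_number_attained assms(1) .
  have "S \<subseteq> (R + T) + V"
    using T(1) set_plus_mono2[OF subset_refl assms(2), of T] by (simp add: ac_simps)
  then have "covering_number V S \<le> card (R + T)"
    by (rule covering_number_le)
  also have "\<dots> \<le> card R * card T"
    by (rule card_set_plus_le)
  finally show ?thesis
    by (simp add: T(2))
qed

lemma covering_number_mult_card_le_card_plus:
  fixes A W H :: "('k::{field,finite} ^ 'n) set"
  assumes "vec.subspace H" and W: "W \<subseteq> {x} + H"
  shows "covering_number H A * card W \<le> card (A + W)"
proof -
  have diff_iff: "{a} + H = {b} + H \<longleftrightarrow> a - b \<in> H" for a b
  proof
    assume "{a} + H = {b} + H"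
    moreover have "a \<in> {a} + H"
      using vec.subspace_0[OF assms(1)] by (force simp: set_plus_def)
    ultimately show "a - b \<in> H"
      by (auto simp: set_plus_def)
  next
    have le: "{a} + H \<subseteq> {b} + H" if "a - b \<in> H" for a b
    proof
      fix z assume "z \<in> {a} + H"
      then obtain h where h: "h \<in> H" "z = b + ((a - b) + h)"
        by (auto simp: set_plus_def)
      then have "(a - b) + h \<in> H"
        using vec.subspace_add[OF assms(1) that] by blast
      then show "z \<in> {b} + H"
        unfolding h(2) by (intro set_plus_intro) auto
    qed
    assume "a - b \<in> H"
    then show "{a} + H = {b} + H"
      using le vec.subspace_neg[OF assms(1), of "a - b"] by (metis minus_diff_eq subset_antisym)
  qed
  \<comment> \<open>\<open>T\<close> is a transversal: one element of \<open>A\<close> from each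
    coset of \<open>H\<close> that \<open>A\<close> meets.\<close>
  obtain T where T: "T \<subseteq> A" "inj_on (\<lambda>a. {a} + H) T" "(\<lambda>a. {a} + H) ` A = (\<lambda>a. {a} + H) ` T"
    using subset_image_inj[of "(\<lambda>a. {a} + H) ` A" "\<lambda>a. {a} + H" A] by auto
  have "A \<subseteq> T + H"
  proof
    fix a assume "a \<in> A"
    then obtain t where "t \<in> T" "a - t \<in> H"
      using T(3) diff_iff by (metis (no_types, lifting) imageE imageI)
    then show "a \<in> T + H"
      by (metis set_plus_intro add.commute diff_add_cancel)
  qed
  then have "covering_number H A * card W \<le> card T * card W"
    by (simp add: covering_number_le)
  \<comment> \<open>Addition is injective on \<open>T \<times> W\<close>: elements of
    \<open>W\<close> differ by elements of \<open>H\<close>, so equal sums put \<open>t\<close> and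
    \<open>t'\<close> in one coset, and a transversal has only one element there.\<close>
  also have "\<dots> = card ((\<lambda>(t, w). t + w) ` (T \<times> W))"
  proof (subst card_image)
    show "inj_on (\<lambda>(t, w). t + w) (T \<times> W)"
    proof (clarsimp simp: inj_on_def)
      fix t w t' w' assume *: "t \<in> T" "w \<in> W" "t' \<in> T" "w' \<in> W" "t + w = t' + w'"
      have "\<exists>h\<in>H. v = x + h" if "v \<in> W" for v
        using subsetD[OF W that] by (auto simp: set_plus_def)
      then obtain h h' where h: "h \<in> H" "h' \<in> H" "w = x + h" "w' = x + h'"
        using *(2,4) by metis
      then have "t - t' = h' - h"
        using *(5) by (simp add: algebra_simps)
      then have "{t} + H = {t'} + H"
        using vec.subspace_diff[OF assms(1) h(2) h(1)] by (simp add: diff_iff)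
      then have "t = t'"
        using T(2) * by (auto dest: inj_onD)
      then show "t = t' \<and> w = w'"
        using *(5) by simp
    qed
  qed (simp add: card_cartesian_product)
  also have "\<dots> \<le> card (A + W)"
    using T(1) by (intro card_mono) auto
  finally show ?thesis .
qed

text \<open>Pigeonhole: an optimal cover of \<open>Y\<close> cuts \<open>Z\<close> into
  \<open>covering_number H Y\<close> pieces, and some piece has at least average size.\<close>

lemma exists_rich_coset:
  fixes H Y Z :: "'a::{monoid_add,finite} set"
  assumes "0 \<in> H" and "Z \<subseteq> Y"
  shows "\<exists>x. card Z \<le> covering_number H Y * card (Z \<inter> ({x} + H))"
proof (rule ccontr)
  assume "\<not> ?thesis"
  then have small: "covering_number H Y * card (Z \<inter> ({x} + H)) < card Z" for x
    by (simp add: not_le)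
  obtain T where T: "Y \<subseteq> T + H" "card T = covering_number H Y"
    using covering_number_attained assms(1) .
  have "Z \<subseteq> (\<Union>t\<in>T. Z \<inter> ({t} + H))"
    using T(1) assms(2) by (fastforce simp: set_plus_def)
  then have "card Z \<le> card (\<Union>t\<in>T. Z \<inter> ({t} + H))"
    by (intro card_mono) auto
  also have "\<dots> \<le> (\<Sum>t\<in>T. card (Z \<inter> ({t} + H)))"
    by (intro card_UN_le) simp
  finally have le: "card Z \<le> (\<Sum>t\<in>T. card (Z \<inter> ({t} + H)))" .
  \<comment> \<open>By \<open>small\<close>, \<open>Z\<close> has positive size, so an empty cover
    is impossible; the strict comparison of sums below relies on this.\<close>
  have "T \<noteq> {}"
    using le small[of 0] by auto
  have "card T * card Z \<le> (\<Sum>t\<in>T. card T * card (Z \<inter> ({t} + H)))"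
    using le by (simp add: sum_distrib_left[symmetric])
  also have "\<dots> < (\<Sum>t\<in>T. card Z)"
    using small \<open>T \<noteq> {}\<close> T(2) by (intro sum_strict_mono) auto
  finally show False
    by simp
qed

lemma covering_number_mult_card_Int_le:
  fixes A Y H :: "('k::{field,finite} ^ 'n) set"
  assumes "vec.subspace H"
  shows "covering_number H A * card (A \<inter> Y) \<le> covering_number H Y * card (A + A)"
proof -
  obtain x where x: "card (A \<inter> Y) \<le> covering_number H Y * card (A \<inter> Y \<inter> ({x} + H))"
    using exists_rich_coset[OF vec.subspace_0[OF assms], of "A \<inter> Y" Y] by auto
  let ?W = "A \<inter> Y \<inter> ({x} + H)"
  have "covering_number H A * card (A \<inter> Y) \<le> covering_number H Y * (covering_number H A * card ?W)"
    using mult_le_mono2[OF x, of "covering_number H A"] by (simp add: ac_simps)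
  also have "\<dots> \<le> covering_number H Y * card (A + ?W)"
    by (intro mult_le_mono2 covering_number_mult_card_le_card_plus[OF assms]) auto
  also have "\<dots> \<le> covering_number H Y * card (A + A)"
    by (intro mult_le_mono2 card_mono set_plus_mono2) auto
  finally show ?thesis .
qed

text \<open>Start from \<open>card (A \<inter> Y) \<ge> \<gamma> * card B - card (B - A)\<close> and
  rewrite \<open>card B\<close> through \<open>card A\<close>. A point of \<open>A - B\<close> then
  costs \<open>\<gamma>\<close>, a point of \<open>B - A\<close> costs \<open>1 - \<gamma>\<close>;
  the larger weight is the maximum in \<open>Delta\<close>.\<close>

lemma Delta_mult_card_le_card_Int:
  fixes A B Y :: "'a::finite set"
  assumes "Y \<subseteq> B"
    and "real (card (sym_diff A B)) \<le> \<eta> * real (card A)"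
    and "real (card Y) \<ge> \<gamma> * real (card B)"
  shows "Delta \<gamma> \<eta> * real (card A) \<le> real (card (A \<inter> Y))"
proof -
  let ?m = "max \<gamma> (1 - \<gamma>)"
  have "card (sym_diff A B) = card (A - B) + card (B - A)"
    by (rule card_Un_disjoint) auto
  moreover have "card A = card (A - B) + card (A \<inter> B)" "card B = card (B - A) + card (A \<inter> B)"
    by (subst card_Un_disjoint[symmetric]; auto intro!: arg_cong[where f = card])+
  moreover have "card Y = card (A \<inter> Y) + card (Y - A)"
    by (subst card_Un_disjoint[symmetric]; auto intro!: arg_cong[where f = card])
  moreover have "card (Y - A) \<le> card (B - A)"
    using assms(1) by (intro card_mono) auto
  ultimately have Y: "real (card (A \<inter> Y)) \<ge> \<gamma> * real (card B) - real (card (B - A))"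
    and B: "real (card B) = real (card A) - real (card (A - B)) + real (card (B - A))"
    and D: "real (card (sym_diff A B)) = real (card (A - B)) + real (card (B - A))"
    using assms(3) by auto
  have "\<gamma> * real (card (A - B)) + (1 - \<gamma>) * real (card (B - A)) \<le> ?m * real (card (sym_diff A B))"
    unfolding D distrib_left by (intro add_mono mult_right_mono) auto
  \<comment> \<open>\<open>?m\<close> is nonnegative for every real \<open>\<gamma>\<close>, as
    \<open>\<gamma>\<close> and \<open>1 - \<gamma>\<close> sum to 1.\<close>
  also have "\<dots> \<le> ?m * (\<eta> * real (card A))"
    using assms(2) by (intro mult_left_mono) auto
  finally show ?thesis
    using Y unfolding B Delta_def by (simp add: algebra_simps)
qed

text \<open>The only scalars are 0 and 1, so a new generator contributes at most one further coset
  of the old span.\<close>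

lemma span_insert_bit:
  fixes d :: "bit ^ 'n"
  shows "vec.span (insert d S) = {0, d} + vec.span S"
proof -
  have "x - k *s d \<in> vec.span S \<longleftrightarrow> (if k = 0 then x else x - d) \<in> vec.span S" for x and k :: bit
    by (cases k) auto
  then have "vec.span (insert d S) = {x. x \<in> vec.span S \<or> x - d \<in> vec.span S}"
    unfolding vec.span_insert by (auto intro: exI[of _ 0] exI[of _ 1])
  also have "\<dots> = {0, d} + vec.span S"
    by (auto simp: set_plus_def) (metis add.commute diff_add_cancel)
  finally show ?thesis .
qed

lemma card_span_insert_bit:
  fixes d :: "bit ^ 'n"
  assumes "d \<notin> vec.span S"
  shows "card (vec.span (insert d S)) = 2 * card (vec.span S)"
proof -
  have "{0, d} + vec.span S = vec.span S \<union> (+) d ` vec.span S"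
    by (auto simp: set_plus_def)
  moreover have "vec.span S \<inter> (+) d ` vec.span S = {}"
  proof -
    have "d + v \<notin> vec.span S" if "v \<in> vec.span S" for v
      using assms vec.span_add_eq2[OF that] by blast
    then show ?thesis
      by blast
  qed
  ultimately show ?thesis
    by (simp add: span_insert_bit card_Un_disjoint card_image)
qed

theorem theorem6p3:
  shows "\<exists>construct :: (bit ^ 'n) set \<Rightarrow> (bit ^ 'n) set.
    \<forall>H D. vec.subspace H \<and> vec.independent D \<and> vec.span D = H \<longrightarrow>
      vec.subspace (construct D) \<and> construct D \<subseteq> H \<and>
      (\<forall>(A :: (bit ^ 'n) set) B Y (K :: real) (P :: real) (\<gamma> :: real) (\<eta> :: real).
        A \<noteq> {} \<and> Y \<subseteq> B \<and>
        real (card (A + A)) \<le> K * real (card A) \<and>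
        real (card (sym_diff A B)) \<le> \<eta> * real (card A) \<and> 0 \<le> \<eta> \<and> \<eta> < 1 \<and>
        real (card Y) \<ge> \<gamma> * real (card B) \<and> 0 < \<gamma> \<and> \<gamma> \<le> 1 \<and>
        card H \<le> card Y \<and>
        real (covering_number H Y) \<le> P \<and>
        Delta \<gamma> \<eta> > 0 \<longrightarrow>
          card (construct D) \<le> card A \<and>
          real (covering_number (construct D) A) \<le> 2 * K * P / Delta \<gamma> \<eta>)"
proof (intro exI[of _ "\<lambda>D. vec.span (D - {SOME d. d \<in> D})"] allI impI, elim conjE, intro conjI allI impI)
  fix H D :: "(bit ^ 'n) set"
  \<comment> \<open>The deleted vector is chosen from \<open>D\<close> alone, before
    \<open>A\<close>, \<open>B\<close>, \<open>Y\<close> and the parameters appear. If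
    \<open>D\<close> is empty, nothing is deleted and \<open>?V\<close> is the zero space.\<close>
  let ?V = "vec.span (D - {SOME d. d \<in> D})"
  assume H: "vec.subspace H" and ind: "vec.independent D" and span: "vec.span D = H"
  show "vec.subspace ?V"
    by simp
  show "?V \<subseteq> H"
    unfolding span[symmetric] by (intro vec.span_mono) auto
  \<comment> \<open>The alternative \<open>card ?V = 1\<close> covers the empty basis, where no
    halving occurs. The set \<open>R\<close> is \<open>{0}\<close> in that case and
    \<open>{0, d}\<close> otherwise.\<close>
  have index: "(card H = 2 * card ?V \<or> card ?V = 1) \<and> (\<exists>R. card R \<le> 2 \<and> H \<subseteq> R + ?V)"
  proof (cases "D = {}")
    case True
    then show ?thesis
      using span by (auto intro!: exI[of _ "{0}"])
  next
    case False
    define d where "d = (SOME d. d \<in> D)"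
    have d: "d \<in> D"
      using False unfolding d_def by (simp add: some_in_eq)
    then have H_eq: "H = vec.span (insert d (D - {d}))"
      using span by (simp add: insert_absorb)
    have "d \<notin> vec.span (D - {d})"
      using ind d unfolding vec.dependent_def by blast
    then show ?thesis
      unfolding d_def[symmetric] H_eq
      using card_span_insert_bit[of d "D - {d}"]
      by (auto simp: span_insert_bit simp del: insert_Diff_single intro!: exI[of _ "{0, d}"] card_insert_le_m1)
  qed
  fix A B Y :: "(bit ^ 'n) set" and K P \<gamma> \<eta> :: real
  assume *: "A \<noteq> {} \<and> Y \<subseteq> B \<and>
        real (card (A + A)) \<le> K * real (card A) \<and>
        real (card (sym_diff A B)) \<le> \<eta> * real (card A) \<and> 0 \<le> \<eta> \<and> \<eta> < 1 \<and>
        real (card Y) \<ge> \<gamma> * real (card B) \<and> 0 < \<gamma> \<and> \<gamma> \<le> 1 \<and>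
        card H \<le> card Y \<and>
        real (covering_number H Y) \<le> P \<and>
        Delta \<gamma> \<eta> > 0"
  have A: "card A > 0"
    using * by (simp add: card_gt_0_iff)
  show "card ?V \<le> card A"
  proof -
    have "card Y \<le> card (A \<union> sym_diff A B)"
      using * by (intro card_mono) auto
    also have "\<dots> \<le> card A + card (sym_diff A B)"
      by (rule card_Un_le)
    finally have "real (card Y) \<le> real (card A) + \<eta> * real (card A)"
      using * by linarith
    \<comment> \<open>Strict because \<open>\<eta> < 1\<close> and \<open>A\<close> is
      nonempty.\<close>
    also have "\<dots> < 2 * real (card A)"
      using * A by simp
    finally have "card H < 2 * card A"
      using * by linarith
    then show ?thesis
      using index A by linarith
  qed
  let ?N = "real (covering_number H A)"
  have "?N * (Delta \<gamma> \<eta> * real (card A)) \<le> ?N * real (card (A \<inter> Y))"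
    using * by (intro mult_left_mono Delta_mult_card_le_card_Int[of Y B A]) auto
  also have "\<dots> \<le> real (covering_number H Y) * real (card (A + A))"
    using covering_number_mult_card_Int_le[OF H, of A Y] by (metis of_nat_le_iff of_nat_mult)
  \<comment> \<open>\<open>P\<close> is nonnegative because it bounds a covering number.\<close>
  also have "\<dots> \<le> P * (K * real (card A))"
    using * by (intro mult_mono) auto
  \<comment> \<open>The positive factor \<open>card A\<close> cancels from both ends of the
    chain.\<close>
  finally have N: "?N * Delta \<gamma> \<eta> \<le> K * P"
    using A by (simp add: mult.assoc[symmetric] mult.commute[of P K])
  obtain R where R: "card R \<le> 2" "H \<subseteq> R + ?V"
    using index by blast
  have "covering_number ?V A \<le> card R * covering_number H A"
    using covering_number_le_mult[OF vec.subspace_0[OF H] R(2)] .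
  then have "covering_number ?V A \<le> 2 * covering_number H A"
    using mult_le_mono1[OF R(1)] order_trans by blast
  then have "real (covering_number ?V A) \<le> 2 * ?N"
    by linarith
  then have "real (covering_number ?V A) * Delta \<gamma> \<eta> \<le> 2 * ?N * Delta \<gamma> \<eta>"
    using * by (intro mult_right_mono) auto
  also have "\<dots> \<le> 2 * K * P"
    using N by simp
  finally show "real (covering_number ?V A) \<le> 2 * K * P / Delta \<gamma> \<eta>"
    using * by (simp add: pos_le_divide_eq)
qed

end
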